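(* Let $R$ be a commutative ring with identity, $S$ a multiplicative subset of $R$, and $M$ an $R$-module. Then $R(+)M$ is a $u$-$S(+)M$-Noetherian ring if and only if $R$ is a $u$-$S$-Noetherian ring and $M$ is a $u$-$S$-Noetherian $R$-module.
   Context: A subset $S$ of a ring is multiplicative if $1\in S$ and $s_1s_2\in S$ for all $s_1,s_2\in S$. For a commutative ring $R$ with multiplicative subset $S$: an $R$-module $N$ is $u$-$S$-Noetherian if there exists $s\in S$ such that for every submodule $L$ of $N$ there is a finitely generated submodule $F\subseteq L$ with $sL\subseteq F$; the ring $R$ is $u$-$S$-Noetherian if it is so as an $R$-module, i.e. there exists $s\in S$ such that for every ideal $I$ there is a finitely generated ideal $K\subseteq I$ with $sI\subseteq K$. The trivial extension $R(+)M$ is $R\oplus M$ with coordinatewise addition and multiplication $(r_1,m_1)(r_2,m_2)=(r_1r_2,\,r_1m_2+r_2m_1)$; it is a commutative ring with identity $(1,0)$. $S(+)M=\{(s,m)\mid s\in S,\ m\in M\}$, which is a multiplicative subset of $R(+)M$. *)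

theory Defs
  imports "HOL-Algebra.Algebra"
begin

text \<open>A multiplicative subset of a ring \<open>R\<close> is a submonoid of its multiplicative monoid,
  that is \<^prop>\<open>submonoid S R\<close>; in particular \<open>S\<close> may contain \<open>\<zero>\<close>.\<close>

definition gen_submodule ::
    "('a, 'r) ring_scheme \<Rightarrow> ('a, 'b, 'm) module_scheme \<Rightarrow> 'b set \<Rightarrow> 'b set"
  where "gen_submodule R M A = \<Inter>{N. submodule N R M \<and> A \<subseteq> N}"

definition fg_submodule ::
    "('a, 'r) ring_scheme \<Rightarrow> ('a, 'b, 'm) module_scheme \<Rightarrow> 'b set \<Rightarrow> bool"
  where "fg_submodule R M F \<longleftrightarrow> (\<exists>A. finite A \<and> A \<subseteq> carrier M \<and> F = gen_submodule R M A)"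

definition fg_ideal :: "('a, 'r) ring_scheme \<Rightarrow> 'a set \<Rightarrow> bool"
  where "fg_ideal R K \<longleftrightarrow> (\<exists>A. finite A \<and> A \<subseteq> carrier R \<and> K = Idl\<^bsub>R\<^esub> A)"

text \<open>The element \<open>s\<close> is uniform: it is chosen before the submodule (or ideal).\<close>

definition u_S_noetherian_module ::
    "('a, 'r) ring_scheme \<Rightarrow> 'a set \<Rightarrow> ('a, 'b, 'm) module_scheme \<Rightarrow> bool"
  where "u_S_noetherian_module R S M \<longleftrightarrow>
    (\<exists>s\<in>S. \<forall>L. submodule L R M \<longrightarrow>
       (\<exists>F. fg_submodule R M F \<and> F \<subseteq> L \<and> (\<lambda>x. s \<odot>\<^bsub>M\<^esub> x) ` L \<subseteq> F))"

definition u_S_noetherian_ring :: "('a, 'r) ring_scheme \<Rightarrow> 'a set \<Rightarrow> bool"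
  where "u_S_noetherian_ring R S \<longleftrightarrow>
    (\<exists>s\<in>S. \<forall>I. ideal I R \<longrightarrow>
       (\<exists>K. fg_ideal R K \<and> K \<subseteq> I \<and> (\<lambda>x. s \<otimes>\<^bsub>R\<^esub> x) ` I \<subseteq> K))"

definition trivial_extension ::
    "('a, 'r) ring_scheme \<Rightarrow> ('a, 'b, 'm) module_scheme \<Rightarrow> ('a \<times> 'b) ring"
  where "trivial_extension R M =
    \<lparr>carrier = carrier R \<times> carrier M,
     monoid.mult = (\<lambda>(r1, m1) (r2, m2). (r1 \<otimes>\<^bsub>R\<^esub> r2, r1 \<odot>\<^bsub>M\<^esub> m2 \<oplus>\<^bsub>M\<^esub> r2 \<odot>\<^bsub>M\<^esub> m1)),
     monoid.one = (\<one>\<^bsub>R\<^esub>, \<zero>\<^bsub>M\<^esub>),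
     ring.zero = (\<zero>\<^bsub>R\<^esub>, \<zero>\<^bsub>M\<^esub>),
     ring.add = (\<lambda>(r1, m1) (r2, m2). (r1 \<oplus>\<^bsub>R\<^esub> r2, m1 \<oplus>\<^bsub>M\<^esub> m2))\<rparr>"

lemma trivial_extension_cring:
  assumes "module R M"
  shows "cring (trivial_extension R M)"
proof -
  interpret module R M by fact
  show ?thesis
  proof (rule cringI)
    show "abelian_group (trivial_extension R M)"
    proof (rule abelian_groupI)
      fix x assume "x \<in> carrier (trivial_extension R M)"
      then show "\<exists>y\<in>carrier (trivial_extension R M).
          y \<oplus>\<^bsub>trivial_extension R M\<^esub> x = \<zero>\<^bsub>trivial_extension R M\<^esub>"
        by (intro bexI[of _ "(\<ominus>\<^bsub>R\<^esub> fst x, \<ominus>\<^bsub>M\<^esub> snd x)"])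
          (auto simp: trivial_extension_def R.l_neg M.l_neg)
    qed (auto simp: trivial_extension_def R.a_ac M.a_ac)
    show "comm_monoid (trivial_extension R M)"
    proof (rule comm_monoidI)
      fix x y z
      assume "x \<in> carrier (trivial_extension R M)" "y \<in> carrier (trivial_extension R M)"
        "z \<in> carrier (trivial_extension R M)"
      then show "x \<otimes>\<^bsub>trivial_extension R M\<^esub> y \<otimes>\<^bsub>trivial_extension R M\<^esub> z =
          x \<otimes>\<^bsub>trivial_extension R M\<^esub> (y \<otimes>\<^bsub>trivial_extension R M\<^esub> z)"
        by (auto simp: trivial_extension_def R.m_ac M.a_ac smult_r_distr smult_assoc1[symmetric])
    qed (auto simp: trivial_extension_def R.m_comm M.a_comm)
  qed (auto simp: trivial_extension_def R.l_distr smult_l_distr smult_r_distr M.a_ac)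
qed

lemma submonoid_trivial_extension:
  assumes "module R M" and "submonoid S R"
  shows "submonoid (S \<times> carrier M) (trivial_extension R M)"
proof -
  interpret module R M by fact
  interpret S: submonoid S R by fact
  show ?thesis
    by unfold_locales (auto simp: trivial_extension_def)
qed

text \<open>The definition through ideals agrees with the definition of a \<open>u\<close>-\<open>S\<close>-Noetherian
  module applied to \<open>R\<close> as a module over itself.\<close>

definition regular_module :: "('a, 'r) ring_scheme \<Rightarrow> ('a, 'a) module"
  where "regular_module R =
    \<lparr>carrier = carrier R, monoid.mult = (\<otimes>\<^bsub>R\<^esub>), monoid.one = \<one>\<^bsub>R\<^esub>,
     ring.zero = \<zero>\<^bsub>R\<^esub>, ring.add = (\<oplus>\<^bsub>R\<^esub>), smult = (\<otimes>\<^bsub>R\<^esub>)\<rparr>"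

lemma submodule_regular_module:
  assumes "cring R"
  shows "submodule I R (regular_module R) \<longleftrightarrow> ideal I R"
proof -
  interpret cring R by fact
  have add: "subgroup I (add_monoid (regular_module R)) \<longleftrightarrow> subgroup I (add_monoid R)"
    by (simp add: regular_module_def subgroup_def m_inv_def)
  show ?thesis
  proof
    assume "submodule I R (regular_module R)"
    then interpret I: submodule I R "regular_module R" .
    have 1: "subgroup I (add_monoid R)"
      using I.subgroup_axioms by (simp add: add)
    have 2: "a \<otimes>\<^bsub>R\<^esub> x \<in> I" if "a \<in> carrier R" "x \<in> I" for a x
      using I.smult_closed[OF that] by (simp add: regular_module_def)
    have 3: "x \<in> carrier R" if "x \<in> I" for x
      using subgroup.mem_carrier[OF 1 that] by simp
    show "ideal I R"
      by (rule idealI[OF ring_axioms 1 2]) (use 2 3 m_comm in metis)+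
  next
    assume "ideal I R"
    then interpret I: ideal I R .
    show "submodule I R (regular_module R)"
      by (intro submodule.intro submodule_axioms.intro)
        (use I.a_subgroup I.I_l_closed add in \<open>auto simp: regular_module_def\<close>)
  qed
qed

lemma u_S_noetherian_ring_iff_module:
  assumes "cring R"
  shows "u_S_noetherian_ring R S \<longleftrightarrow> u_S_noetherian_module R S (regular_module R)"
  using submodule_regular_module[OF assms]
  by (simp add: u_S_noetherian_ring_def u_S_noetherian_module_def fg_ideal_def fg_submodule_def
      gen_submodule_def genideal_def regular_module_def)

end

theory Submission
  imports Defs
begin

text \<open>An ideal \<open>I\<close> of \<open>R\<close> and a submodule \<open>N\<close> of \<open>M\<close> give the ideals \<open>I (+) M\<close> and \<open>0 (+) N\<close> of
  \<open>R (+) M\<close>, and the two coordinates of a finite generating set of the approximating ideal generate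
  approximations of \<open>I\<close> and \<open>N\<close>. Conversely, an ideal \<open>J\<close> of \<open>R (+) M\<close> has a first projection
  \<open>I\<close> and a fibre \<open>N = {n. (0, n) \<in> J}\<close> over \<open>0\<close>. If \<open>s\<close> and \<open>t\<close> are uniform for \<open>R\<close> and \<open>M\<close>,
  lift generators approximating \<open>I\<close> to \<open>J\<close> and add generators approximating \<open>N\<close>. For \<open>(r, m)\<close> in
  \<open>J\<close>, the resulting ideal contains some \<open>(s r, m')\<close>; then \<open>s m - m'\<close> lies in \<open>N\<close>, so
  \<open>(0, t (s m - m'))\<close> and hence \<open>(t s, 0) (r, m)\<close> lie in the resulting ideal.\<close>

section \<open>Generated submodules and a closure criterion for ideals\<close>

lemma gen_submodule_minimal:
  assumes "submodule N R M" "A \<subseteq> N"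
  shows "gen_submodule R M A \<subseteq> N"
  using assms unfolding gen_submodule_def by blast

lemma gen_submodule_superset: "A \<subseteq> gen_submodule R M A"
  unfolding gen_submodule_def by blast

text \<open>Negation is multiplication by \<open>\<ominus> \<one>\<close>, and commutativity turns
  left absorption into right absorption, so these closure conditions suffice.\<close>

lemma (in cring) idealI_add_mult:
  assumes sub: "I \<subseteq> carrier R" and zero: "\<zero> \<in> I"
    and add: "\<And>a b. \<lbrakk>a \<in> I; b \<in> I\<rbrakk> \<Longrightarrow> a \<oplus> b \<in> I"
    and mult: "\<And>a c. \<lbrakk>a \<in> I; c \<in> carrier R\<rbrakk> \<Longrightarrow> c \<otimes> a \<in> I"
  shows "ideal I R"
proof (rule idealI[OF ring_axioms _ mult])
  show "subgroup I (add_monoid R)"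
  proof (rule add.subgroupI[OF sub _ _ add])
    show "I \<noteq> {}" using zero by blast
    show "\<ominus> a \<in> I" if a: "a \<in> I" for a
    proof -
      have "a \<in> carrier R" using a sub by blast
      then show ?thesis using mult[OF a, of "\<ominus> \<one>"] by (simp add: l_minus)
    qed
  qed
  show "a \<otimes> c \<in> I" if a: "a \<in> I" and c: "c \<in> carrier R" for a c
  proof -
    have "a \<in> carrier R" using a sub by blast
    then show ?thesis using mult[OF a c] m_comm[of a c] c by simp
  qed
qed

context module
begin

section \<open>Coordinate formulas in the trivial extension, and submodules of
  \<open>M\<close>\<close>

abbreviation E where "E \<equiv> trivial_extension R M"

lemma trivial_extension_carrier [simp]: "carrier E = carrier R \<times> carrier M"
  and trivial_extension_mult [simp]:
    "(a, x) \<otimes>\<^bsub>E\<^esub> (b, y) = (a \<otimes> b, a \<odot>\<^bsub>M\<^esub> y \<oplus>\<^bsub>M\<^esub> b \<odot>\<^bsub>M\<^esub> x)"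
  and trivial_extension_add [simp]: "(a, x) \<oplus>\<^bsub>E\<^esub> (b, y) = (a \<oplus> b, x \<oplus>\<^bsub>M\<^esub> y)"
  and trivial_extension_zero [simp]: "\<zero>\<^bsub>E\<^esub> = (\<zero>, \<zero>\<^bsub>M\<^esub>)"
  by (simp_all add: trivial_extension_def)

lemma trivial_extension_is_cring: "cring E"
  by (rule trivial_extension_cring[OF module_axioms])

lemma trivial_extension_a_inv [simp]:
  assumes "a \<in> carrier R" "x \<in> carrier M"
  shows "\<ominus>\<^bsub>E\<^esub> (a, x) = (\<ominus> a, \<ominus>\<^bsub>M\<^esub> x)"
proof -
  interpret E: cring E by (rule trivial_extension_is_cring)
  show ?thesis
    by (rule E.minus_equality) (use assms in \<open>auto simp: R.l_neg M.l_neg\<close>)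
qed

text \<open>As for ideals, additive inverses come from scalar multiplication by
  \<open>\<ominus> \<one>\<close>.\<close>

lemma submoduleI_add_smult:
  assumes sub: "N \<subseteq> carrier M" and zero: "\<zero>\<^bsub>M\<^esub> \<in> N"
    and add: "\<And>x y. \<lbrakk>x \<in> N; y \<in> N\<rbrakk> \<Longrightarrow> x \<oplus>\<^bsub>M\<^esub> y \<in> N"
    and smult: "\<And>a x. \<lbrakk>a \<in> carrier R; x \<in> N\<rbrakk> \<Longrightarrow> a \<odot>\<^bsub>M\<^esub> x \<in> N"
  shows "submodule N R M"
proof (rule submoduleI[OF sub zero _ add smult])
  fix x assume x: "x \<in> N"
  have "\<ominus>\<^bsub>M\<^esub> x = (\<ominus> \<one>) \<odot>\<^bsub>M\<^esub> x"
    using x sub by (auto simp: smult_l_minus)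
  then show "\<ominus>\<^bsub>M\<^esub> x \<in> N"
    using smult[OF _ x, of "\<ominus> \<one>"] by simp
qed

lemma submodule_zero:
  assumes "submodule N R M"
  shows "\<zero>\<^bsub>M\<^esub> \<in> N"
  using subgroup.one_closed[OF submodule.axioms(1)[OF assms]] by simp

text \<open>The closure conditions pass to intersections. This makes a generated submodule available
  as the second factor of an ideal of \<open>E\<close>.\<close>

lemma submodule_gen_submodule:
  assumes "A \<subseteq> carrier M"
  shows "submodule (gen_submodule R M A) R M"
proof (rule submoduleI_add_smult)
  show "gen_submodule R M A \<subseteq> carrier M"
    by (rule gen_submodule_minimal[OF carrier_is_submodule assms])
  show "\<zero>\<^bsub>M\<^esub> \<in> gen_submodule R M A"
    unfolding gen_submodule_def using submodule_zero by blast
  show "x \<oplus>\<^bsub>M\<^esub> y \<in> gen_submodule R M A"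
    if "x \<in> gen_submodule R M A" "y \<in> gen_submodule R M A" for x y
    using that submoduleE(5) unfolding gen_submodule_def by simp
  show "a \<odot>\<^bsub>M\<^esub> x \<in> gen_submodule R M A"
    if "a \<in> carrier R" "x \<in> gen_submodule R M A" for a x
    using that submoduleE(4) unfolding gen_submodule_def by simp
qed

lemma fg_submoduleE:
  assumes "fg_submodule R M F"
  obtains A where "finite A" "A \<subseteq> carrier M" "F = gen_submodule R M A" "A \<subseteq> F"
proof -
  obtain A where A: "finite A" "A \<subseteq> carrier M" "F = gen_submodule R M A"
    using assms unfolding fg_submodule_def by blast
  show thesis
    by (rule that[OF A]) (simp add: A gen_submodule_superset)
qed

section \<open>Ideals of the trivial extension and their traces on \<open>R\<close> and
  \<open>M\<close>\<close>

lemma ideal_Times_trivial_extension: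
  assumes I: "ideal I R" and N: "submodule N R M"
    and IM: "\<And>a x. \<lbrakk>a \<in> I; x \<in> carrier M\<rbrakk> \<Longrightarrow> a \<odot>\<^bsub>M\<^esub> x \<in> N"
  shows "ideal (I \<times> N) E"
proof -
  interpret E: cring E by (rule trivial_extension_is_cring)
  interpret I: ideal I R by fact
  note N_closed = submoduleE[OF N] submodule_zero[OF N]
  show ?thesis
    \<comment> \<open>The second coordinate of \<open>(c, y)\<close> times \<open>(a, x)\<close> is
      \<open>c x + a y\<close>. The term \<open>c x\<close> stays in \<open>N\<close> because
      \<open>N\<close> is a submodule, and \<open>a y\<close> does so by \<open>IM\<close>.\<close>
    by (rule E.idealI_add_mult)
      (use N_closed IM I.Icarr I.I_l_closed additive_subgroup.zero_closed[OF I.additive_subgroup_axioms]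
        additive_subgroup.a_closed[OF I.additive_subgroup_axioms] in auto)
qed

lemma ideal_fst_image:
  assumes "ideal J E"
  shows "ideal (fst ` J) R"
proof -
  interpret J: ideal J E by fact
  have sub: "J \<subseteq> carrier R \<times> carrier M"
    using J.a_subset by simp
  show ?thesis
  proof (rule R.idealI_add_mult)
    show "fst ` J \<subseteq> carrier R" using sub by auto
    show "\<zero> \<in> fst ` J"
      using additive_subgroup.zero_closed[OF J.additive_subgroup_axioms] by force
    show "a \<oplus> b \<in> fst ` J" if ab: "a \<in> fst ` J" "b \<in> fst ` J" for a b
    proof -
      obtain x y where xy: "(a, x) \<in> J" "(b, y) \<in> J" using ab by force
      show ?thesis
        using additive_subgroup.a_closed[OF J.additive_subgroup_axioms xy] by force
    qed
    show "c \<otimes> a \<in> fst ` J" if a: "a \<in> fst ` J" and c: "c \<in> carrier R" for a c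
    proof -
      obtain x where x: "(a, x) \<in> J" using a by force
      \<comment> \<open>Any lift of \<open>c\<close> to \<open>E\<close> would serve; the one with
        second coordinate zero is chosen.\<close>
      have "(c, \<zero>\<^bsub>M\<^esub>) \<otimes>\<^bsub>E\<^esub> (a, x) \<in> J"
        using J.I_l_closed[OF x, of "(c, \<zero>\<^bsub>M\<^esub>)"] c by simp
      then show ?thesis by force
    qed
  qed
qed

text \<open>Multiplying \<open>(0, x)\<close> by the lift \<open>(a, 0)\<close> gives
  \<open>(0, a x)\<close>, so absorption in \<open>J\<close> becomes closure of the fibre under
  scalars.\<close>

lemma submodule_zero_fibre:
  assumes "ideal J E"
  shows "submodule {x. (\<zero>, x) \<in> J} R M"
proof -
  interpret J: ideal J E by fact
  have sub: "J \<subseteq> carrier R \<times> carrier M"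
    using J.a_subset by simp
  show ?thesis
  proof (rule submoduleI_add_smult)
    show "{x. (\<zero>, x) \<in> J} \<subseteq> carrier M" using sub by auto
    show "\<zero>\<^bsub>M\<^esub> \<in> {x. (\<zero>, x) \<in> J}"
      using additive_subgroup.zero_closed[OF J.additive_subgroup_axioms] by simp
    show "x \<oplus>\<^bsub>M\<^esub> y \<in> {x. (\<zero>, x) \<in> J}"
      if "x \<in> {x. (\<zero>, x) \<in> J}" "y \<in> {x. (\<zero>, x) \<in> J}" for x y
      using that additive_subgroup.a_closed[OF J.additive_subgroup_axioms, of "(\<zero>, x)" "(\<zero>, y)"] by simp
    show "a \<odot>\<^bsub>M\<^esub> x \<in> {x. (\<zero>, x) \<in> J}"
      if "a \<in> carrier R" "x \<in> {x. (\<zero>, x) \<in> J}" for a x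
    proof -
      have "x \<in> carrier M" using that sub by auto
      then show ?thesis
        using that J.I_l_closed[of "(\<zero>, x)" "(a, \<zero>\<^bsub>M\<^esub>)"] by simp
    qed
  qed
qed

section \<open>Descent from the trivial extension to \<open>R\<close> and to
  \<open>M\<close>\<close>

lemma u_S_noetherian_ring_of_trivial_extension:
  assumes "u_S_noetherian_ring E (S \<times> carrier M)"
  shows "u_S_noetherian_ring R S"
proof -
  interpret E: cring E by (rule trivial_extension_is_cring)
  obtain s m where sm: "s \<in> S" "m \<in> carrier M"
    and unif: "\<And>J. ideal J E \<Longrightarrow>
      \<exists>K. fg_ideal E K \<and> K \<subseteq> J \<and> (\<lambda>z. (s, m) \<otimes>\<^bsub>E\<^esub> z) ` J \<subseteq> K"
    using assms unfolding u_S_noetherian_ring_def by blast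
  show ?thesis
    unfolding u_S_noetherian_ring_def
  \<comment> \<open>The projection to \<open>R\<close> is multiplicative, so the first coordinate
    \<open>s\<close> of the uniform element of \<open>E\<close> is the candidate for
    \<open>R\<close>.\<close>
  proof (intro bexI[OF _ sm(1)] allI impI)
    fix I assume I: "ideal I R"
    \<comment> \<open>Stated for arbitrary \<open>I'\<close> because it serves twice: for
      \<open>I\<close> itself and for the ideal generated by the first coordinates of
      \<open>A\<close>.\<close>
    have ideal_Times: "ideal (I' \<times> carrier M) E" if "ideal I' R" for I'
      by (rule ideal_Times_trivial_extension[OF that carrier_is_submodule])
        (use ideal.Icarr[OF that] in simp)
    obtain A where A: "finite A" "A \<subseteq> carrier E" "Idl\<^bsub>E\<^esub> A \<subseteq> I \<times> carrier M"
      and mult: "(\<lambda>z. (s, m) \<otimes>\<^bsub>E\<^esub> z) ` (I \<times> carrier M) \<subseteq> Idl\<^bsub>E\<^esub> A"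
      using unif[OF ideal_Times[OF I]] unfolding fg_ideal_def by blast
    have A_I: "fst ` A \<subseteq> I"
      using E.genideal_self[OF A(2)] A(3) by auto
    have A_R: "fst ` A \<subseteq> carrier R" using A(2) by auto
    have A_A': "fst ` A \<subseteq> Idl\<^bsub>R\<^esub> (fst ` A)" by (rule R.genideal_self[OF A_R])
    \<comment> \<open>The right-hand side is an ideal containing \<open>A\<close>, so minimality
      bounds the first coordinates of the generated ideal without describing its elements.\<close>
    have "Idl\<^bsub>E\<^esub> A \<subseteq> (Idl\<^bsub>R\<^esub> (fst ` A)) \<times> carrier M"
      by (rule E.genideal_minimal[OF ideal_Times[OF R.genideal_ideal[OF A_R]]])
        (use A_A' A(2) in force)
    \<comment> \<open>Apply \<open>mult\<close> to a pair \<open>(a, x)\<close> with any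
      \<open>x\<close> in \<open>M\<close> and read off the first coordinate.\<close>
    then have "s \<otimes> a \<in> Idl\<^bsub>R\<^esub> (fst ` A)" if "a \<in> I" for a
      using mult that by force
    then have "(\<lambda>a. s \<otimes> a) ` I \<subseteq> Idl\<^bsub>R\<^esub> (fst ` A)" by blast
    moreover have "Idl\<^bsub>R\<^esub> (fst ` A) \<subseteq> I" by (rule R.genideal_minimal[OF I A_I])
    ultimately show "\<exists>K. fg_ideal R K \<and> K \<subseteq> I \<and> (\<lambda>a. s \<otimes> a) ` I \<subseteq> K"
      using A(1) A_R unfolding fg_ideal_def by (intro exI[of _ "Idl\<^bsub>R\<^esub> (fst ` A)"]) auto
  qed
qed

lemma u_S_noetherian_module_of_trivial_extension:
  assumes S: "S \<subseteq> carrier R" and "u_S_noetherian_ring E (S \<times> carrier M)"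
  shows "u_S_noetherian_module R S M"
proof -
  interpret E: cring E by (rule trivial_extension_is_cring)
  obtain s m where sm: "s \<in> S" "m \<in> carrier M"
    and unif: "\<And>J. ideal J E \<Longrightarrow>
      \<exists>K. fg_ideal E K \<and> K \<subseteq> J \<and> (\<lambda>z. (s, m) \<otimes>\<^bsub>E\<^esub> z) ` J \<subseteq> K"
    using assms(2) unfolding u_S_noetherian_ring_def by blast
  show ?thesis
    unfolding u_S_noetherian_module_def
  proof (intro bexI[OF _ sm(1)] allI impI)
    fix N assume N: "submodule N R M"
    have ideal_Times: "ideal ({\<zero>} \<times> N') E" if "submodule N' R M" for N'
      by (rule ideal_Times_trivial_extension[OF R.zeroideal that])
        (use submodule_zero[OF that] in simp)
    obtain A where A: "finite A" "A \<subseteq> carrier E" "Idl\<^bsub>E\<^esub> A \<subseteq> {\<zero>} \<times> N"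
      and mult: "(\<lambda>z. (s, m) \<otimes>\<^bsub>E\<^esub> z) ` ({\<zero>} \<times> N) \<subseteq> Idl\<^bsub>E\<^esub> A"
      using unif[OF ideal_Times[OF N]] unfolding fg_ideal_def by blast
    let ?F = "gen_submodule R M (snd ` A)"
    have A_N: "A \<subseteq> {\<zero>} \<times> N"
      using E.genideal_self[OF A(2)] A(3) by blast
    have A_M: "snd ` A \<subseteq> carrier M" using A(2) by auto
    have "A \<subseteq> {\<zero>} \<times> ?F"
      using A_N gen_submodule_superset[of "snd ` A" R M] by force
    then have "Idl\<^bsub>E\<^esub> A \<subseteq> {\<zero>} \<times> ?F"
      by (rule E.genideal_minimal[OF ideal_Times[OF submodule_gen_submodule[OF A_M]]])
    \<comment> \<open>The unwanted \<open>m\<close> is multiplied by the zero first coordinate, so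
      \<open>(s, m)\<close> acts on the second factor as the scalar \<open>s\<close>.\<close>
    moreover have "(s, m) \<otimes>\<^bsub>E\<^esub> (\<zero>, x) = (\<zero>, s \<odot>\<^bsub>M\<^esub> x)" if "x \<in> N" for x
      using that submoduleE(1)[OF N] S sm by (auto dest!: subsetD)
    ultimately have "(\<lambda>x. s \<odot>\<^bsub>M\<^esub> x) ` N \<subseteq> ?F"
      using mult by force
    moreover have "?F \<subseteq> N" by (rule gen_submodule_minimal[OF N]) (use A_N in auto)
    ultimately show "\<exists>F. fg_submodule R M F \<and> F \<subseteq> N \<and> (\<lambda>x. s \<odot>\<^bsub>M\<^esub> x) ` N \<subseteq> F"
      using A(1) A_M unfolding fg_submodule_def by (intro exI[of _ ?F]) auto
  qed
qed

section \<open>Ascent from \<open>R\<close> and \<open>M\<close> to the trivial extension\<close>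

lemma u_S_noetherian_trivial_extension:
  assumes S: "submonoid S R"
    and "u_S_noetherian_ring R S" and "u_S_noetherian_module R S M"
  shows "u_S_noetherian_ring E (S \<times> carrier M)"
proof -
  interpret E: cring E by (rule trivial_extension_is_cring)
  interpret S: submonoid S R by fact
  obtain s where s: "s \<in> S" and unif_R: "\<And>I. ideal I R \<Longrightarrow>
      \<exists>K. fg_ideal R K \<and> K \<subseteq> I \<and> (\<lambda>a. s \<otimes> a) ` I \<subseteq> K"
    using assms(2) unfolding u_S_noetherian_ring_def by blast
  obtain t where t: "t \<in> S" and unif_M: "\<And>N. submodule N R M \<Longrightarrow>
      \<exists>F. fg_submodule R M F \<and> F \<subseteq> N \<and> (\<lambda>x. t \<odot>\<^bsub>M\<^esub> x) ` N \<subseteq> F"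
    using assms(3) unfolding u_S_noetherian_module_def by blast
  have [simp]: "s \<in> carrier R" "t \<in> carrier R" using s t by auto
  \<comment> \<open>This uniform element depends only on \<open>s\<close> and \<open>t\<close>,
    hence is fixed before \<open>J\<close>: \<open>s\<close> treats first coordinates, and
    \<open>t\<close> then treats the error left in the fibre over zero.\<close>
  have ts: "(t \<otimes> s, \<zero>\<^bsub>M\<^esub>) \<in> S \<times> carrier M" using s t by auto
  show ?thesis
    unfolding u_S_noetherian_ring_def
  proof (intro bexI[OF _ ts] allI impI)
    fix J assume J: "ideal J E"
    interpret J: ideal J E by fact
    obtain A where A: "finite A" "A \<subseteq> carrier R" "Idl\<^bsub>R\<^esub> A \<subseteq> fst ` J"
      and mult_R: "(\<lambda>a. s \<otimes> a) ` fst ` J \<subseteq> Idl\<^bsub>R\<^esub> A"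
      using unif_R[OF ideal_fst_image[OF J]] unfolding fg_ideal_def by blast
    obtain F where F: "fg_submodule R M F" "F \<subseteq> {x. (\<zero>, x) \<in> J}"
      and mult_M: "(\<lambda>x. t \<odot>\<^bsub>M\<^esub> x) ` {x. (\<zero>, x) \<in> J} \<subseteq> F"
      using unif_M[OF submodule_zero_fibre[OF J]] by blast
    obtain C where C: "finite C" "F = gen_submodule R M C" "C \<subseteq> F"
      using F(1) by (rule fg_submoduleE)
    have "A \<subseteq> fst ` J" using R.genideal_self[OF A(2)] A(3) by blast
    \<comment> \<open>A finite subset of an image is the image of a finite subset, which gives
      finitely many lifts of the generators in \<open>A\<close>.\<close>
    then obtain B where B: "B \<subseteq> J" "finite B" "A = fst ` B"
      using A(1) by (meson finite_subset_image)
    define G where "G = B \<union> Pair \<zero> ` C"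
    have G_J: "G \<subseteq> J" unfolding G_def using B(1) C(3) F(2) by blast
    then have G_E: "G \<subseteq> carrier E" using J.a_subset by blast
    have G_fin: "finite G" unfolding G_def using B(2) C(1) by simp
    define L where "L = Idl\<^bsub>E\<^esub> G"
    have L: "ideal L E" unfolding L_def by (rule E.genideal_ideal[OF G_E])
    interpret L: ideal L E by (rule L)
    have G_L: "G \<subseteq> L" unfolding L_def by (rule E.genideal_self[OF G_E])
    have L_J: "L \<subseteq> J" unfolding L_def by (rule E.genideal_minimal[OF J G_J])
    \<comment> \<open>Since \<open>fst\<close> maps \<open>L\<close> onto an ideal of
      \<open>R\<close> containing \<open>A\<close>, every element of the ideal generated by
      \<open>A\<close> lifts to \<open>L\<close>.\<close>
    have A_L: "Idl\<^bsub>R\<^esub> A \<subseteq> fst ` L"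
      by (rule R.genideal_minimal[OF ideal_fst_image[OF L]]) (use G_L B(3) in \<open>auto simp: G_def\<close>)
    have F_L: "F \<subseteq> {x. (\<zero>, x) \<in> L}"
      unfolding C(2)
      by (rule gen_submodule_minimal[OF submodule_zero_fibre[OF L]])
        (use G_L in \<open>auto simp: G_def\<close>)
    have "(t \<otimes> s, \<zero>\<^bsub>M\<^esub>) \<otimes>\<^bsub>E\<^esub> (r, m) \<in> L" if rm: "(r, m) \<in> J" for r m
    proof -
      have [simp]: "r \<in> carrier R" "m \<in> carrier M" using rm J.a_subset by auto
      have "s \<otimes> r \<in> fst ` L" using mult_R A_L rm by force
      then obtain m' where m': "(s \<otimes> r, m') \<in> L" by force
      then have [simp]: "m' \<in> carrier M" using L.a_subset by auto
      \<comment> \<open>Both pairs have first coordinate \<open>s r\<close>, so their difference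
        lies over zero. Membership is only in \<open>J\<close>, as \<open>(r, m)\<close> need not
        lie in \<open>L\<close>; multiplying by \<open>t\<close> moves it into
        \<open>L\<close>.\<close>
      have "(s, \<zero>\<^bsub>M\<^esub>) \<otimes>\<^bsub>E\<^esub> (r, m) \<oplus>\<^bsub>E\<^esub> (\<ominus>\<^bsub>E\<^esub> (s \<otimes> r, m')) \<in> J"
        using rm m' L_J by (intro additive_subgroup.a_closed[OF J.additive_subgroup_axioms] J.I_l_closed
            additive_subgroup.a_inv_closed[OF J.additive_subgroup_axioms]) auto
      then have "(\<zero>, s \<odot>\<^bsub>M\<^esub> m \<ominus>\<^bsub>M\<^esub> m') \<in> J"
        by (simp add: R.r_neg M.minus_eq)
      then have "(\<zero>, t \<odot>\<^bsub>M\<^esub> (s \<odot>\<^bsub>M\<^esub> m \<ominus>\<^bsub>M\<^esub> m')) \<in> L"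
        using mult_M F_L by blast
      moreover have "(t, \<zero>\<^bsub>M\<^esub>) \<otimes>\<^bsub>E\<^esub> (s \<otimes> r, m') \<in> L"
        using L.I_l_closed[OF m', of "(t, \<zero>\<^bsub>M\<^esub>)"] by simp
      \<comment> \<open>The two \<open>t m'\<close> terms cancel, leaving
        \<open>(t s r, t s m)\<close>.\<close>
      ultimately have "(\<zero>, t \<odot>\<^bsub>M\<^esub> (s \<odot>\<^bsub>M\<^esub> m \<ominus>\<^bsub>M\<^esub> m')) \<oplus>\<^bsub>E\<^esub> (t, \<zero>\<^bsub>M\<^esub>) \<otimes>\<^bsub>E\<^esub> (s \<otimes> r, m') \<in> L"
        by (rule additive_subgroup.a_closed[OF L.additive_subgroup_axioms])
      then show ?thesis
        by (simp add: M.minus_eq smult_r_distr smult_r_minus smult_assoc1 R.m_assoc M.a_assoc M.l_neg)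
    qed
    then have "(\<lambda>z. (t \<otimes> s, \<zero>\<^bsub>M\<^esub>) \<otimes>\<^bsub>E\<^esub> z) ` J \<subseteq> L" by auto
    then show "\<exists>K. fg_ideal E K \<and> K \<subseteq> J \<and> (\<lambda>z. (t \<otimes> s, \<zero>\<^bsub>M\<^esub>) \<otimes>\<^bsub>E\<^esub> z) ` J \<subseteq> K"
      using L_J G_fin G_E unfolding fg_ideal_def L_def by blast
  qed
qed

end

theorem proposition3p1:
  fixes R :: "('a, 'r) ring_scheme" and M :: "('a, 'b, 'm) module_scheme" and S :: "'a set"
  assumes "cring R" and "submonoid S R" and "module R M"
  shows "u_S_noetherian_ring (trivial_extension R M) (S \<times> carrier M) \<longleftrightarrow>
    u_S_noetherian_ring R S \<and> u_S_noetherian_module R S M"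
  using module.u_S_noetherian_ring_of_trivial_extension[OF assms(3)]
    module.u_S_noetherian_module_of_trivial_extension[OF assms(3) submonoid.subset[OF assms(2)]]
    module.u_S_noetherian_trivial_extension[OF assms(3,2)]
  by blast

end
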